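(* Consider the control system $\dot x = f(x,u)$ with $x\in\mathbb{R}^n$, $u\in\mathbb{R}^m$, together with a dynamically defined controller $\dot u=\phi(x,u,t)$. Suppose the safe set $\mathcal{S}=\{(x,u)\in\mathbb{R}^n\times\mathbb{R}^m : h(x,u)\ge 0\}$ is defined by an integral control barrier function $h:\mathbb{R}^n\times\mathbb{R}^m\to\mathbb{R}$ (with associated functions $p$ and $d$). Modify the dynamically defined controller to $$\dot u=\phi(x,u,t)+v^*(x,u,t),$$ where $v^*$ is the solution of the quadratic program $$v^*(x,u,t)=\operatorname*{argmin}_{v\in\mathbb{R}^m}\ \|v\|^2\quad\text{s.t.}\quad p(x,u)^\top v\ \ge\ d(x,u,t).$$ Then $\mathcal{S}$ is forward invariant (safe) for the closed-loop system $\dot x=f(x,u)$, $\dot u=\phi(x,u,t)+v^*(x,u,t)$: if $(x(0),u(0))\in\mathcal{S}$, then $(x(t),u(t))\in\mathcal{S}$ for all $t\ge 0$.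
   Context: Standing assumptions: $f:\mathbb{R}^n\times\mathbb{R}^m\to\mathbb{R}^n$ is continuously differentiable, and such that $\dot x(t)=f(x(t),u(t))$ has a unique solution for all $t\ge0$ for every bounded piecewise-continuous $u(t)$ and every initial state; $\phi:\mathbb{R}^n\times\mathbb{R}^m\times\mathbb{R}\to\mathbb{R}^m$ is continuously differentiable. $\gamma:\mathbb{R}\to\mathbb{R}$ is a fixed continuous extended class-$\mathcal{K}$ function, i.e. monotone increasing with $\gamma(0)=0$. For a continuously differentiable $h:\mathbb{R}^n\times\mathbb{R}^m\to\mathbb{R}$ having $0$ as a regular value, define $$p(x,u):=\Big(\frac{\partial h}{\partial u}(x,u)\Big)^{\top}\in\mathbb{R}^m,$$ $$d(x,u,t):=-\Big(\frac{\partial h}{\partial x}(x,u)f(x,u)+\frac{\partial h}{\partial u}(x,u)\phi(x,u,t)+\gamma(h(x,u))\Big)\in\mathbb{R}.$$ Definition. $h$ is an integral control barrier function (I-CBF) for the system $\dot x=f(x,u)$, $\dot u=\phi(x,u,t)+v$ (with auxiliary input $v\in\mathbb{R}^m$) if for all $(x,u)\in\mathbb{R}^n\times\mathbb{R}^m$ and all $t\ge 0$: $p(x,u)=0\Rightarrow d(x,u,t)\le 0$. Convention: $(x(t),u(t))$ denotes any solution of the closed-loop differential equations on $[0,\infty)$; forward invariance of a set means that every such solution starting in the set remains in it for all $t\ge0$. *)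

theory Defs
  imports "HOL-Analysis.Analysis"
begin

definition continuously_differentiable ::
    "('a::real_normed_vector \<Rightarrow> 'b::real_normed_vector) \<Rightarrow> bool" where
  "continuously_differentiable g \<longleftrightarrow>
     (\<exists>g'. (\<forall>z. (g has_derivative blinfun_apply (g' z)) (at z)) \<and> continuous_on UNIV g')"

definition regular_value ::
    "('a::real_normed_vector \<Rightarrow> 'b::real_normed_vector) \<Rightarrow> 'b \<Rightarrow> bool" where
  "regular_value g c \<longleftrightarrow> (\<forall>z. g z = c \<longrightarrow> surj (frechet_derivative g (at z)))"

text \<open>
  Vector of partial derivatives. The row vector \<open>\<partial>g/\<partial>y\<close> acts on a vector \<open>w\<close> as
  \<open>gradient g y \<bullet> w\<close>.
\<close>
definition gradient :: "(real^'k \<Rightarrow> real) \<Rightarrow> real^'k \<Rightarrow> real^'k" where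
  "gradient g y = (\<chi> i. frechet_derivative g (at y) (axis i 1))"

text \<open>
  On \<open>[0, \<infinity>)\<close>: finitely many discontinuities in every compact interval, and finite one-sided
  limits at every point. At \<open>0\<close> continuity means right-continuity.
\<close>
definition piecewise_continuous :: "(real \<Rightarrow> 'b::topological_space) \<Rightarrow> bool" where
  "piecewise_continuous u \<longleftrightarrow>
     (\<forall>T. finite {t \<in> {0..T}. \<not> continuous (at t within {0..}) u}) \<and>
     (\<forall>t\<ge>0. \<exists>l. (u \<longlongrightarrow> l) (at_right t)) \<and>
     (\<forall>t>0. \<exists>l. (u \<longlongrightarrow> l) (at_left t))"

text \<open>
  For an input with jumps, a trajectory is continuous and satisfies the differential equation
  wherever the input is continuous.
\<close>
definition trajectory ::
    "('a::real_normed_vector \<times> 'b::real_normed_vector \<Rightarrow> 'a) \<Rightarrow> (real \<Rightarrow> 'b) \<Rightarrow> (real \<Rightarrow> 'a) \<Rightarrow> bool" where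
  "trajectory f u x \<longleftrightarrow>
     continuous_on {0..} x \<and>
     (\<forall>t\<ge>0. continuous (at t within {0..}) u \<longrightarrow>
        (x has_vector_derivative f (x t, u t)) (at t within {0..}))"

definition uniquely_solvable ::
    "('a::real_normed_vector \<times> 'b::real_normed_vector \<Rightarrow> 'a) \<Rightarrow> bool" where
  "uniquely_solvable f \<longleftrightarrow>
     (\<forall>u x0. bounded (u ` {0..}) \<and> piecewise_continuous u \<longrightarrow>
        (\<exists>x. trajectory f u x \<and> x 0 = x0 \<and>
             (\<forall>y. trajectory f u y \<and> y 0 = x0 \<longrightarrow> (\<forall>t\<ge>0. y t = x t))))"

text \<open>
  Monotone is taken in the weak sense, which includes the strictly increasing functions.
\<close>
definition extended_class_K :: "(real \<Rightarrow> real) \<Rightarrow> bool" where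
  "extended_class_K \<gamma> \<longleftrightarrow> mono \<gamma> \<and> \<gamma> 0 = 0"

definition cbf_p :: "((real^'n) \<times> (real^'m) \<Rightarrow> real) \<Rightarrow> real^'n \<Rightarrow> real^'m \<Rightarrow> real^'m" where
  "cbf_p h x u = gradient (\<lambda>w. h (x, w)) u"

definition cbf_d ::
    "((real^'n) \<times> (real^'m) \<Rightarrow> real^'n) \<Rightarrow> ((real^'n) \<times> (real^'m) \<times> real \<Rightarrow> real^'m) \<Rightarrow>
     (real \<Rightarrow> real) \<Rightarrow> ((real^'n) \<times> (real^'m) \<Rightarrow> real) \<Rightarrow> real^'n \<Rightarrow> real^'m \<Rightarrow> real \<Rightarrow> real" where
  "cbf_d f \<phi> \<gamma> h x u t =
     - (gradient (\<lambda>y. h (y, u)) x \<bullet> f (x, u) + gradient (\<lambda>w. h (x, w)) u \<bullet> \<phi> (x, u, t)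
        + \<gamma> (h (x, u)))"

definition integral_CBF ::
    "((real^'n) \<times> (real^'m) \<Rightarrow> real^'n) \<Rightarrow> ((real^'n) \<times> (real^'m) \<times> real \<Rightarrow> real^'m) \<Rightarrow>
     (real \<Rightarrow> real) \<Rightarrow> ((real^'n) \<times> (real^'m) \<Rightarrow> real) \<Rightarrow> bool" where
  "integral_CBF f \<phi> \<gamma> h \<longleftrightarrow>
     continuously_differentiable h \<and> regular_value h 0 \<and>
     (\<forall>x u. \<forall>t\<ge>0. cbf_p h x u = 0 \<longrightarrow> cbf_d f \<phi> \<gamma> h x u t \<le> 0)"

definition v_star ::
    "((real^'n) \<times> (real^'m) \<Rightarrow> real^'n) \<Rightarrow> ((real^'n) \<times> (real^'m) \<times> real \<Rightarrow> real^'m) \<Rightarrow>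
     (real \<Rightarrow> real) \<Rightarrow> ((real^'n) \<times> (real^'m) \<Rightarrow> real) \<Rightarrow> real^'n \<Rightarrow> real^'m \<Rightarrow> real \<Rightarrow> real^'m" where
  "v_star f \<phi> \<gamma> h x u t =
     arg_min (\<lambda>v. (norm v)\<^sup>2) (\<lambda>v. cbf_p h x u \<bullet> v \<ge> cbf_d f \<phi> \<gamma> h x u t)"

definition closed_loop ::
    "('a \<times> 'b \<Rightarrow> 'a) \<Rightarrow> ('a \<times> 'b \<times> real \<Rightarrow> 'b::plus) \<Rightarrow> ('a \<Rightarrow> 'b \<Rightarrow> real \<Rightarrow> 'b) \<Rightarrow>
     real \<Rightarrow> 'a \<times> 'b \<Rightarrow> 'a \<times> 'b" where
  "closed_loop f \<phi> v t = (\<lambda>(x, u). (f (x, u), \<phi> (x, u, t) + v x u t))"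

text \<open>Classical solutions on \<open>[0, \<infinity>)\<close>, with the one-sided derivative at \<open>0\<close>.\<close>
definition ode_solution ::
    "(real \<Rightarrow> 'a::real_normed_vector \<Rightarrow> 'a) \<Rightarrow> (real \<Rightarrow> 'a) \<Rightarrow> bool" where
  "ode_solution F z \<longleftrightarrow> (\<forall>t\<ge>0. (z has_vector_derivative F t (z t)) (at t within {0..}))"

definition forward_invariant ::
    "(real \<Rightarrow> 'a::real_normed_vector \<Rightarrow> 'a) \<Rightarrow> 'a set \<Rightarrow> bool" where
  "forward_invariant F S \<longleftrightarrow>
     (\<forall>z. ode_solution F z \<and> z 0 \<in> S \<longrightarrow> (\<forall>t\<ge>0. z t \<in> S))"

definition safe_set :: "('a \<Rightarrow> real) \<Rightarrow> 'a set" where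
  "safe_set h = {z. h z \<ge> 0}"

end

theory Submission
  imports Defs
begin

text \<open>
  Along a solution of the modified closed loop, write \<open>H t\<close> for the value of the barrier \<open>h\<close> at time
  \<open>t\<close>. By the chain rule \<open>H' t\<close> is the sum of the drift terms and of \<open>p \<bullet> v\<^sup>*\<close>, and the quantity \<open>d\<close>
  is chosen exactly so that the constraint \<open>p \<bullet> v\<^sup>* \<ge> d\<close> becomes \<open>H' t \<ge> - \<gamma> (H t)\<close>
  (\<open>derivative_along_closed_loop_ge\<close>). The constraint does hold at \<open>v\<^sup>*\<close>: the barrier condition says
  that the half-space of admissible \<open>v\<close> is nonempty, and a nonempty closed set has a point of
  least norm (\<open>v_star_feasible\<close>).

  Since \<open>\<gamma>\<close> is monotone with \<open>\<gamma> 0 = 0\<close>, the inequality gives \<open>H' t \<ge> 0\<close> whenever \<open>H t < 0\<close>. So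
  \<open>H\<close>, starting at a nonnegative value, cannot become negative: after the last time at which it
  is nonnegative it would have to decrease while its derivative is nonnegative
  (\<open>nonneg_if_deriv_nonneg_below_zero\<close>). Using only the sign of \<open>\<gamma>\<close> on the negative axis avoids a
  comparison with solutions of \<open>y' = - \<gamma> y\<close>, which need not be unique.
\<close>

lemma inner_gradient:
  fixes g :: "real^'k \<Rightarrow> real"
  assumes "(g has_derivative g') (at y)"
  shows "gradient g y \<bullet> w = g' w"
proof -
  interpret g': bounded_linear g'
    using assms by (rule has_derivative_bounded_linear)
  have "g' w = g' (\<Sum>i\<in>UNIV. w $ i *\<^sub>R axis i 1)"
    by (simp add: basis_expansion flip: scalar_mult_eq_scaleR)
  also have "\<dots> = (\<Sum>i\<in>UNIV. w $ i * g' (axis i 1))"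
    by (simp add: g'.sum g'.scaleR)
  also have "\<dots> = gradient g y \<bullet> w"
    using frechet_derivative_at[OF assms]
    by (simp add: gradient_def inner_vec_def mult.commute)
  finally show ?thesis ..
qed

lemma derivative_eq_partial_gradients:
  fixes h :: "(real^'n) \<times> (real^'m) \<Rightarrow> real"
  assumes "(h has_derivative h') (at (x, u))"
  shows "h' (a, b) = gradient (\<lambda>y. h (y, u)) x \<bullet> a + gradient (\<lambda>w. h (x, w)) u \<bullet> b"
proof -
  interpret h': bounded_linear h'
    using assms by (rule has_derivative_bounded_linear)
  have "((\<lambda>y. (y, u)) has_derivative (\<lambda>w. (w, 0))) (at x)"
    by (auto intro!: derivative_eq_intros)
  from diff_chain_at[OF this, of h h'] assms
  have "((\<lambda>y. h (y, u)) has_derivative (\<lambda>w. h' (w, 0))) (at x)"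
    by (simp add: o_def)
  moreover
  have "((\<lambda>w. (x, w)) has_derivative (\<lambda>w. (0, w))) (at u)"
    by (auto intro!: derivative_eq_intros)
  from diff_chain_at[OF this, of h h'] assms
  have "((\<lambda>w. h (x, w)) has_derivative (\<lambda>w. h' (0, w))) (at u)"
    by (simp add: o_def)
  ultimately show ?thesis
    using h'.add[of "(a, 0)" "(0, b)"] by (simp add: inner_gradient)
qed

text \<open>
  The definite choice \<open>arg_min\<close> says something about its value only if a minimizer exists; for a
  nonempty closed set of competitors in a Euclidean space it is a point nearest to the origin.
\<close>
lemma arg_min_norm_in_closed:
  fixes C :: "'a::euclidean_space set"
  assumes "closed C" and "C \<noteq> {}"
  shows "arg_min (\<lambda>v. (norm v)\<^sup>2) (\<lambda>v. v \<in> C) \<in> C"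
proof -
  obtain v where "v \<in> C" and nearest: "\<And>w. w \<in> C \<Longrightarrow> dist 0 v \<le> dist 0 w"
    using distance_attains_inf[OF assms, of 0] by blast
  show ?thesis
  proof (rule arg_minI[where P = "\<lambda>v. v \<in> C" and x = v])
    show "v \<in> C" by fact
    show "\<not> (norm w)\<^sup>2 < (norm v)\<^sup>2" if "w \<in> C" for w
      using nearest[OF that] by (simp add: not_less power_mono)
  qed
qed

lemma halfspace_nonempty:
  fixes p :: "'a::real_inner"
  assumes "p = 0 \<Longrightarrow> d \<le> 0"
  shows "{v. p \<bullet> v \<ge> d} \<noteq> {}"
proof (cases "p = 0")
  case True
  then show ?thesis using assms by auto
next
  case False
  then have "p \<bullet> ((d / (p \<bullet> p)) *\<^sub>R p) = d" by simp
  then show ?thesis by (metis (mono_tags, lifting) empty_iff mem_Collect_eq order_refl)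
qed

text \<open>
  The barrier condition at a point is exactly feasibility of the quadratic program there: the
  half-space is empty only if \<open>p = 0\<close> and \<open>d > 0\<close>.
\<close>
lemma v_star_feasible:
  assumes "integral_CBF f \<phi> \<gamma> h" and "t \<ge> 0"
  shows "cbf_p h x u \<bullet> v_star f \<phi> \<gamma> h x u t \<ge> cbf_d f \<phi> \<gamma> h x u t"
proof -
  have "{v. cbf_p h x u \<bullet> v \<ge> cbf_d f \<phi> \<gamma> h x u t} \<noteq> {}"
    using assms by (intro halfspace_nonempty) (auto simp: integral_CBF_def)
  from arg_min_norm_in_closed[OF closed_halfspace_ge this] show ?thesis
    by (simp add: v_star_def)
qed

text \<open>
  The constraint of the quadratic program is the differential inequality \<open>H' \<ge> - \<gamma> H\<close> in disguise:
  \<open>- d - \<gamma> (h (x, u))\<close> is the rate of change of \<open>h\<close> under the unmodified controller, and the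
  correction adds \<open>p \<bullet> v\<^sup>*\<close> to it.
\<close>
lemma derivative_along_closed_loop_ge:
  assumes "integral_CBF f \<phi> \<gamma> h" and "t \<ge> 0"
    and "(h has_derivative h') (at z)"
  shows "h' (closed_loop f \<phi> (v_star f \<phi> \<gamma> h) t z) \<ge> - \<gamma> (h z)"
proof -
  obtain x u where z: "z = (x, u)" by fastforce
  show ?thesis
    using v_star_feasible[OF assms(1,2), of x u] derivative_eq_partial_gradients[of h h' x u] assms(3)
    unfolding z closed_loop_def cbf_p_def cbf_d_def by (simp add: inner_add_right)
qed

text \<open>
  The derivative has to be controlled only where the function is already negative. After the last
  time \<open>s\<close> with \<open>g s \<ge> 0\<close> this control is available at every point, so \<open>g\<close> cannot drop below \<open>g s\<close>.
\<close>
lemma nonneg_if_deriv_nonneg_below_zero: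
  fixes g g' :: "real \<Rightarrow> real"
  assumes deriv: "\<And>t. t \<ge> 0 \<Longrightarrow> (g has_real_derivative g' t) (at t within {0..})"
    and below: "\<And>t. t \<ge> 0 \<Longrightarrow> g t < 0 \<Longrightarrow> g' t \<ge> 0"
    and "g 0 \<ge> 0" and "T \<ge> 0"
  shows "g T \<ge> 0"
proof (rule ccontr)
  assume "\<not> g T \<ge> 0"
  have cont: "continuous_on {0..} g"
    using deriv by (auto intro!: DERIV_continuous_on)
  define N where "N = {t \<in> {0..T}. g t \<ge> 0}"
  have "closed N"
    unfolding N_def using continuous_on_subset[OF cont]
    by (intro continuous_on_closed_Collect_le) auto
  then have "compact N"
    by (metis (lifting) N_def closed_Int_compact compact_Icc inf.absorb1 mem_Collect_eq subsetI)
  moreover have "0 \<in> N" using assms(3,4) by (simp add: N_def)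
  ultimately obtain s where "s \<in> N" and last: "\<And>t. t \<in> N \<Longrightarrow> t \<le> s"
    using compact_attains_sup[of N] by blast
  then have s: "0 \<le> s" "s < T" "g s \<ge> 0"
    using \<open>\<not> g T \<ge> 0\<close> by (auto simp: N_def order.order_iff_strict)
  have "g s \<le> g T"
  proof (rule DERIV_nonneg_imp_increasing_open[where f = g])
    show "\<exists>y. (g has_real_derivative y) (at t) \<and> y \<ge> 0" if t: "s < t" "t < T" for t
    proof -
      have "g t < 0" using last[of t] s t by (force simp: N_def)
      then have "g' t \<ge> 0" using below[of t] s t by simp
      moreover have "at t within {0..} = at t"
        using s t by (intro at_within_interior) simp
      ultimately show ?thesis using deriv[of t] s t by auto
    qed
    show "continuous_on {s..T} g"
      using s by (auto intro: continuous_on_subset[OF cont])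
  qed (use s in simp)
  with s \<open>\<not> g T \<ge> 0\<close> show False by simp
qed

text \<open>
  A version of Nagumo's condition for superlevel sets that asks for a nonnegative derivative along
  the vector field at all points outside the set.
\<close>
lemma forward_invariant_safe_setI:
  fixes h :: "'a::real_normed_vector \<Rightarrow> real"
  assumes h: "\<And>z. (h has_derivative h' z) (at z)"
    and outside: "\<And>t z. t \<ge> 0 \<Longrightarrow> h z < 0 \<Longrightarrow> h' z (F t z) \<ge> 0"
  shows "forward_invariant F (safe_set h)"
  unfolding forward_invariant_def
proof (intro allI impI, elim conjE)
  fix z and T :: real
  assume z: "ode_solution F z" and init: "z 0 \<in> safe_set h" and "T \<ge> 0"
  have "0 \<le> (h \<circ> z) T"
  proof (rule nonneg_if_deriv_nonneg_below_zero[where g = "h \<circ> z"])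
    show "(h \<circ> z has_real_derivative h' (z t) (F t (z t))) (at t within {0..})" if "t \<ge> 0" for t
      using vector_derivative_diff_chain_within[of z "F t (z t)" t "{0..}" h "h' (z t)"] z that
      by (auto simp: ode_solution_def has_real_derivative_iff_has_vector_derivative
          intro: has_derivative_at_withinI[OF h])
    show "h' (z t) (F t (z t)) \<ge> 0" if "t \<ge> 0" "(h \<circ> z) t < 0" for t
      using outside that by simp
    show "(h \<circ> z) 0 \<ge> 0" using init by (simp add: safe_set_def)
  qed (fact \<open>T \<ge> 0\<close>)
  then show "z T \<in> safe_set h" by (simp add: safe_set_def)
qed

theorem theorem1:
  fixes f :: "(real^'n) \<times> (real^'m) \<Rightarrow> real^'n"
    and \<phi> :: "(real^'n) \<times> (real^'m) \<times> real \<Rightarrow> real^'m"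
    and \<gamma> :: "real \<Rightarrow> real"
    and h :: "(real^'n) \<times> (real^'m) \<Rightarrow> real"
  assumes "continuously_differentiable f"
    and "uniquely_solvable f"
    and "continuously_differentiable \<phi>"
    and "continuous_on UNIV \<gamma>"
    and "extended_class_K \<gamma>"
    and "integral_CBF f \<phi> \<gamma> h"
  shows "forward_invariant (closed_loop f \<phi> (v_star f \<phi> \<gamma> h)) (safe_set h)"
proof -
  obtain h' where h': "\<And>z. (h has_derivative blinfun_apply (h' z)) (at z)"
    using assms(6) unfolding integral_CBF_def continuously_differentiable_def by blast
  show ?thesis
  proof (rule forward_invariant_safe_setI[OF h'])
    fix t :: real and z
    assume "t \<ge> 0" and "h z < 0"
    have "\<gamma> (h z) \<le> 0"
      using assms(5) \<open>h z < 0\<close> by (metis extended_class_K_def less_imp_le monoD)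
    then show "h' z (closed_loop f \<phi> (v_star f \<phi> \<gamma> h) t z) \<ge> 0"
      using derivative_along_closed_loop_ge[OF assms(6) \<open>t \<ge> 0\<close> h'] by (smt (verit))
  qed
qed

end
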